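(* Let $K\subset\mathbb{R}$ be a regular compact set, let $g$ be the Green function of $\overline{\mathbb{C}}\setminus K$ with pole at infinity, and for $\delta>0$ put $$G(\delta):=\max\{ g(z): z\in\mathbb{C},\ \operatorname{dist}(z,K)\le 2\delta\}.$$ Let $n\ge 1$ and let $x_0,\ldots,x_{n-1}\in K$ be (the first $n$ terms of) a Leja sequence. Then, for every $\delta>0$, the $n$-th Lebesgue constant satisfies $$\Lambda_n\le 2n\left[ \frac{\operatorname{diam}(K)}{\delta}\, e^{nG(\delta)}\right]^{9/8}.$$
   Context: A compact set $K\subset\mathbb{C}$ is regular if the Green function $g(z)=g_{\overline{\mathbb{C}}\setminus K}(z,\infty)$ of $\overline{\mathbb{C}}\setminus K$ with pole at infinity is continuous on $\mathbb{C}$ (with $g=0$ on $K$). A sequence $x_0,x_1,\ldots$ of points of $K$ is a Leja sequence if $x_0\in K$ is arbitrary and, for every $k\ge1$, $x_k$ is a point of global maximum on $K$ of $x\mapsto\prod_{j<k}|x-x_j|$. $C(K)$ is the space of continuous functions $f:K\to\mathbb{C}$ with the uniform norm. The Lagrange interpolation operator $T_n:C(K)\to C(K)$ is $T_nf(x)=\sum_{k=0}^{n-1}f(x_k)L_{k,n}(x)$, where $L_{k,n}(x)=\prod_{0\le j\le n-1,\,j\ne k}\frac{x-x_j}{x_k-x_j}$, and the $n$-th Lebesgue constant is the operator norm $\Lambda_n=\|T_n\|$. *)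

theory Defs
  imports "HOL-Complex_Analysis.Complex_Analysis"
begin

definition harmonic_on :: "complex set \<Rightarrow> (complex \<Rightarrow> real) \<Rightarrow> bool" where
  "harmonic_on U u \<longleftrightarrow> open U \<and>
     (\<forall>z\<in>U. \<exists>r>0. \<exists>f. ball z r \<subseteq> U \<and> f holomorphic_on ball z r \<and>
        (\<forall>w\<in>ball z r. u w = Re (f w)))"

text \<open>g is the Green function of the complement of the compact set K with pole at
infinity, and it is continuous on the whole plane with g = 0 on K (K regular).\<close>
definition regular_green :: "complex set \<Rightarrow> (complex \<Rightarrow> real) \<Rightarrow> bool" where
  "regular_green K g \<longleftrightarrow>
     harmonic_on (- K) g \<and>
     (\<exists>R C. \<forall>z. R \<le> cmod z \<longrightarrow> \<bar>g z - ln (cmod z)\<bar> \<le> C) \<and>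
     continuous_on UNIV g \<and> (\<forall>z\<in>K. g z = 0)"

definition leja_prefix :: "complex set \<Rightarrow> (nat \<Rightarrow> complex) \<Rightarrow> nat \<Rightarrow> bool" where
  "leja_prefix K x n \<longleftrightarrow>
     (\<forall>k<n. x k \<in> K \<and>
        (k \<ge> 1 \<longrightarrow> (\<forall>y\<in>K. (\<Prod>j<k. cmod (y - x j)) \<le> (\<Prod>j<k. cmod (x k - x j)))))"

definition lagrange_basis :: "(nat \<Rightarrow> complex) \<Rightarrow> nat \<Rightarrow> nat \<Rightarrow> complex \<Rightarrow> complex" where
  "lagrange_basis x k n t = (\<Prod>j\<in>{0..<n} - {k}. (t - x j) / (x k - x j))"

definition lagrange_interp :: "(nat \<Rightarrow> complex) \<Rightarrow> nat \<Rightarrow> (complex \<Rightarrow> complex) \<Rightarrow> complex \<Rightarrow> complex" where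
  "lagrange_interp x n f t = (\<Sum>k<n. f (x k) * lagrange_basis x k n t)"

definition lebesgue_const :: "complex set \<Rightarrow> (nat \<Rightarrow> complex) \<Rightarrow> nat \<Rightarrow> real" where
  "lebesgue_const K x n =
     Sup {(SUP t\<in>K. cmod (lagrange_interp x n f t)) | f.
            continuous_on K f \<and> (SUP t\<in>K. cmod (f t)) \<le> 1}"

definition green_G :: "complex set \<Rightarrow> (complex \<Rightarrow> real) \<Rightarrow> real \<Rightarrow> real" where
  "green_G K g \<delta> = Sup (g ` {z. infdist z K \<le> 2 * \<delta>})"

end

theory Submission
  imports Defs
begin

text \<open>Fix a node \<open>x\<^sub>k\<close>, shift it to the origin, and let \<open>f\<^sub>m\<close> be the modulus of its fundamental polynomial for
the nodes chosen up to a certain step. A new node \<open>y\<close> multiplies \<open>f\<^sub>m(s)\<close> by \<open>\<bar>1 - s/y\<bar>\<close>, and the Leja property says that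
\<open>f\<^sub>m(s) \<bar>s\<bar> \<le> f\<^sub>m(y) \<bar>y\<bar>\<close> on the set. For points \<open>-u < 0 < t\<close> of the set consider the geometric mean
\<open>f\<^sub>m(t)\<close> to the power \<open>u/(u+t)\<close> times \<open>f\<^sub>m(-u)\<close> to the power \<open>t/(u+t)\<close>. Because the weighted mean of \<open>t\<close> and \<open>-u\<close> is 0, a node
outside \<open>(-u, t)\<close> does not increase it; if the node lies inside, the Leja property bounds the new mean by the old mean
for the shorter interval having the node as an end point, and the loss is controlled by the shrinking of the interval.
All nodes stay at distance at least \<open>d = \<delta> exp(-n G(\<delta>))\<close> from the origin, by the Bernstein--Walsh inequality and
the maximum principle on a circle of radius \<open>2\<delta>\<close>, so the total loss is at most \<open>2 (diam K / d)\<close> to the power 9/8.\<close>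

subsection \<open>Logarithmic inequalities\<close>

text \<open>The true value is 1.0986; the first case of \<open>entropy_type_bound\<close> closes for
  any bound up to 4/3 - 9/40 = 1.1083, so a rational just below that is enough.\<close>

lemma ln_three_le: "ln (3::real) \<le> 1108 / 1000"
proof -
  have "exp (1::real) \<ge> 1 + 1 + 1/2 + 1/6 + 1/24 + 1/120"
  proof -
    have "(\<Sum>k<6. (1::real)^k /\<^sub>R fact k) \<le> exp 1"
      unfolding exp_def by (intro sum_le_suminf summable_exp_generic) auto
    thus ?thesis by (simp add: numeral_eq_Suc divide_simps)
  qed
  moreover have "exp (108/1000::real) \<ge> 1 + 108/1000 + (108/1000)^2/2"
    by (rule exp_lower_Taylor_quadratic) simp
  ultimately have "(1 + 1 + 1/2 + 1/6 + 1/24 + 1/120) * (1 + 108/1000 + (108/1000)^2/2)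
      \<le> exp (1::real) * exp (108/1000)"
    by (intro mult_mono) auto
  also have "\<dots> = exp (1108/1000)" by (simp flip: exp_add)
  finally have "3 \<le> exp (1108/1000::real)" by (simp add: power2_eq_square)
  thus ?thesis using ln_le_cancel_iff[of 3 "exp (1108/1000)"] by simp
qed

lemma ln_le_scaled:
  fixes c z :: real assumes "c > 0" "z > 0" shows "ln z \<le> ln c + z / c - 1"
  using ln_le_minus_one[of "z / c"] assms by (simp add: ln_div)

lemma inv_exp_one_le: "exp (-1 :: real) \<le> 2 / 5"
  using exp_lower_Taylor_quadratic[of "1::real"] by (simp add: exp_minus field_simps)

text \<open>The tangent of \<open>ln\<close> at 3 is what produces the bound 1/3: the maximum of the left-hand side,
about 0.311, is attained near 1/4, where \<open>(1 - x) / x = 3\<close>.\<close>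

lemma entropy_type_bound:
  fixes x :: real assumes "0 < x" "x < 1"
  shows "(x - 1/8) * ln (1 - x) - x * ln x \<le> 1/3"
\<comment> \<open>Below 2/5 the tangent at 3 is paired with -ln (1 - x) \<le> x + 2x^2. Above 2/5
  the cruder bounds ln (1 - x) \<le> -x and -x ln x \<le> 1/e leave at most 2/5 - 11/100 <
  1/3.\<close>
proof (cases "x \<le> 2/5")
  case True
  have "ln ((1 - x) / x) \<le> ln 3 + ((1 - x) / x) / 3 - 1"
    using assms by (intro ln_le_scaled) auto
  hence "x * (ln (1 - x) - ln x) \<le> x * (ln 3 + ((1 - x) / x) / 3 - 1)"
    using assms by (intro mult_left_mono) (auto simp: ln_div)
  also have "\<dots> = x * ln 3 + (1 - x) / 3 - x" using assms by (simp add: field_simps)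
  also have "\<dots> \<le> x * (1108/1000) + (1 - x) / 3 - x"
    using mult_left_mono[OF ln_three_le, of x] assms by simp
  finally have 1: "x * (ln (1 - x) - ln x) \<le> x * (1108/1000) + (1 - x) / 3 - x" .
  have 2: "- ln (1 - x) \<le> x + 2 * x * x"
    using ln_one_minus_pos_lower_bound[of x] assms True by (simp add: power2_eq_square)
  have "x * x \<le> (2/5) * x" using True assms by (intro mult_right_mono) auto
  hence "- ln (1 - x) / 8 \<le> x * (9 / 40)" using 2 by simp
  hence "x * (ln (1 - x) - ln x) + - ln (1 - x) / 8
      \<le> (x * (1108/1000) + (1 - x) / 3 - x) + x * (9 / 40)"
    using 1 by (rule add_mono[rotated])
  also have "\<dots> \<le> 1/3" using assms by (simp add: field_simps)
  also have "x * (ln (1 - x) - ln x) + - ln (1 - x) / 8 = (x - 1/8) * ln (1 - x) - x * ln x"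
    by (simp add: algebra_simps)
  finally show ?thesis .
next
  case False
  have "ln (1 - x) \<le> - x" using ln_le_minus_one[of "1 - x"] assms by simp
  hence 1: "(x - 1/8) * ln (1 - x) \<le> (x - 1/8) * (- x)" using False by (intro mult_left_mono) auto
  have "(x - 1/8) * x \<ge> (2/5 - 1/8) * (2/5)" using False by (intro mult_mono) auto
  moreover have "- x * ln x \<le> 2/5"
  proof -
    have "- ln x \<le> exp (-1) / x"
      using ln_le_scaled[of "exp 1" "1 / x"] assms by (simp add: ln_div exp_minus field_simps)
    hence "x * (- ln x) \<le> x * (exp (-1) / x)" using assms by (intro mult_left_mono) auto
    thus ?thesis using inv_exp_one_le assms by simp
  qed
  ultimately show ?thesis using 1 by (simp add: algebra_simps)
qed

text \<open>The left-hand side is ln (1 - z) + 8 ln z at z = 5/6, the tangent point in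
  \<open>recip_ln_nonpos\<close>. After exponentiation the claim is e^3 (e^0.06)^4 \<le> 6^9 /
  5^8.\<close>

lemma ln_const_bound: "ln (1/6::real) + 8 * ln (5/6) \<le> -324/100"
proof -
  have "exp (6/100::real) \<le> 1 + 6/100 + (6/100)^2" by (rule exp_bound) auto
  hence "exp (6/100::real) ^ 4 \<le> (1 + 6/100 + (6/100)^2) ^ 4" by (rule power_mono) simp
  moreover have "exp (1::real) ^ 3 \<le> (272/100) ^ 3"
    using e_less_272 by (intro power_mono) auto
  ultimately have "exp (1::real) ^ 3 * exp (6/100::real) ^ 4
      \<le> (272/100)^3 * (1 + 6/100 + (6/100)^2) ^ 4"
    by (intro mult_mono) auto
  also have "exp (1::real) ^ 3 * exp (6/100::real) ^ 4 = exp (324/100)"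
    by (simp flip: exp_of_nat_mult exp_add)
  also have "(272/100::real)^3 * (1 + 6/100 + (6/100)^2) ^ 4 \<le> 6^9 / 5^8" by (simp add: power2_eq_square power_divide)
  finally have "ln (exp (324/100)) \<le> ln (6^9 / 5^8 :: real)"
    by (subst ln_le_cancel_iff) auto
  also have "\<dots> = 9 * ln 6 - 8 * ln 5"
    using ln_realpow[of 6 9] ln_realpow[of 5 8] by (subst ln_div) (simp_all del: power_numeral)
  finally show ?thesis by (simp add: ln_div)
qed

text \<open>What remains of \<open>two_variable_bound\<close> once \<open>entropy_type_bound\<close>
  has replaced the terms in x by (8/y)(1/3). The derivative vanishes near 0.358 and 0.827, so on
  [1/e, 1) there is a single maximum, about -0.05, close to 5/6.\<close>

definition recip_ln :: "real \<Rightarrow> real" where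
  "recip_ln y = 8/3 / y + ln (1 - y) + 8 * ln y"

lemma recip_ln_deriv:
  assumes "0 < y" "y < 1"
  shows "(recip_ln has_real_derivative - (27 * y^2 - 32 * y + 8) / (3 * y^2 * (1 - y))) (at y)"
  unfolding recip_ln_def
  apply (rule derivative_eq_intros refl | use assms in simp; fail)+
  using assms by (simp add: divide_simps power2_eq_square) (simp add: algebra_simps)

lemma recip_ln_le_left:
  assumes "exp (-1) \<le> y" "y \<le> 4/5"
  shows "recip_ln y \<le> recip_ln (4/5)"
proof (rule DERIV_nonneg_imp_nondecreasing[OF assms(2)])
  fix x assume x: "y \<le> x" "x \<le> 4/5"
  have "exp 1 < (272/100 :: real)" by (rule e_less_272)
  hence "exp (-1) \<ge> (100/272 :: real)" by (simp add: exp_minus field_simps)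
  hence x': "100/272 \<le> x" using x assms by simp
  \<comment> \<open>A convex quadratic lies below its chord, and 27x^2 - 32x + 8 is negative at 4/5
    and at 100/272, a rational lower bound for 1/e.\<close>
  have "(x - 100/272) * (x - 4/5) \<le> 0" using x x' by (intro mult_nonneg_nonpos) auto
  hence "x^2 \<le> (100/272 + 4/5) * x - 100/272 * (4/5)" by (simp add: field_simps power2_eq_square)
  hence "27 * x^2 - 32 * x + 8 \<le> 0" using x x' by simp
  hence "- (27 * x^2 - 32 * x + 8) / (3 * x^2 * (1 - x)) \<ge> 0"
    using x x' by (intro divide_nonneg_nonneg) auto
  thus "\<exists>d. (recip_ln has_real_derivative d) (at x) \<and> 0 \<le> d"
    using x x' recip_ln_deriv[of x] by (intro exI conjI) auto
qed

lemma recip_ln_le_right: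
  assumes "95/100 \<le> y" "y < 1"
  shows "recip_ln y \<le> recip_ln (95/100)"
proof (rule DERIV_nonpos_imp_nonincreasing[OF assms(1)])
  fix x :: real assume x: "95/100 \<le> x" "x \<le> y"
  have "95/100 * x \<le> x * x" using x by (intro mult_right_mono) auto
  hence "27 * x^2 - 32 * x + 8 \<ge> 0" using x assms unfolding power2_eq_square by linarith
  hence "- (27 * x^2 - 32 * x + 8) / (3 * x^2 * (1 - x)) \<le> 0"
    using x assms by (intro divide_nonpos_nonneg) auto
  thus "\<exists>d. (recip_ln has_real_derivative d) (at x) \<and> d \<le> 0"
    using x assms recip_ln_deriv[of x] by (intro exI conjI) auto
qed

lemma recip_ln_nonpos:
  fixes y :: real assumes "exp (-1) \<le> y" "y < 1"
  shows "recip_ln y \<le> 0"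
proof -
  \<comment> \<open>Around the maximum monotonicity gives nothing: the tangents of \<open>ln\<close>
    at 1/6 and 5/6 reduce the claim to a quadratic, again bounded by its chord. Monotonicity then
    moves the outer ranges to the end points of this one.\<close>
  have mid: "recip_ln z \<le> 0" if z: "4/5 \<le> z" "z \<le> 95/100" for z :: real
  proof -
    have "ln (1 - z) \<le> ln (1/6) + (1 - z) / (1/6) - 1" using z by (intro ln_le_scaled) auto
    moreover have "ln z \<le> ln (5/6) + z / (5/6) - 1" using z by (intro ln_le_scaled) auto
    ultimately have "recip_ln z \<le> 8/3 / z + 18/5 * z - 624/100"
      using ln_const_bound by (simp add: recip_ln_def)
    also have "\<dots> = (18/5 * z^2 - 624/100 * z + 8/3) / z"
      using z by (simp add: field_simps power2_eq_square)
    also have "\<dots> \<le> 0"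
    proof (rule divide_nonpos_pos)
      have "(z - 4/5) * (z - 95/100) \<le> 0" using z by (intro mult_nonneg_nonpos) auto
      hence "z^2 \<le> 7/4 * z - 76/100" by (simp add: field_simps power2_eq_square)
      thus "18/5 * z^2 - 624/100 * z + 8/3 \<le> 0" using z by simp
    qed (use z in auto)
    finally show ?thesis .
  qed
  show ?thesis using recip_ln_le_left[of y] recip_ln_le_right[of y] mid[of y] mid[of "4/5"] mid[of "95/100"] assms
    by (cases "y \<le> 4/5"; cases "y \<le> 95/100") auto
qed

text \<open>This is 8 times the inequality left over in \<open>interval_shrinking_step\<close>. For
  y \<ge> 1/e the two one-variable bounds combine; for smaller y the main terms are controlled by ln
  y \<le> -1 and -\<theta> ln \<theta> \<le> 1 - \<theta>, where \<theta> = x / y.\<close>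

lemma two_variable_bound:
  fixes x y :: real assumes "0 < x" "x < y" "y < 1"
  shows "8 * ln y - 8 * (x / y) * ln x + (8 * (x / y) - 1) * ln (1 - x) + ln (1 - y) \<le> 0"
proof (cases "exp (-1) \<le> y")
  case True
  have "ln (1 - x) \<le> 0" using assms by simp
  hence "(1 / y - 1) * ln (1 - x) \<le> 0" using assms by (intro mult_nonneg_nonpos) auto
  moreover have "(8 / y) * ((x - 1/8) * ln (1 - x) - x * ln x) \<le> (8 / y) * (1/3)"
    using assms by (intro mult_left_mono entropy_type_bound) auto
  moreover have "8/3 / y + ln (1 - y) + 8 * ln y \<le> 0" using True assms recip_ln_nonpos[of y] by (simp add: recip_ln_def)
  moreover have "8 / y * ((x - 1/8) * ln (1 - x) - x * ln x)
     = 8 * (x/y) * ln (1-x) - (1/y) * ln (1 - x) - 8 * (x / y) * ln x"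
    by (simp add: algebra_simps diff_divide_distrib)
  ultimately show ?thesis by (simp add: algebra_simps)
next
  case False
  have "ln y \<le> ln (exp (-1))" using False assms by (subst ln_le_cancel_iff) auto
  hence y: "ln y \<le> -1" by simp
  define \<theta> where "\<theta> = x / y"
  have \<theta>: "0 < \<theta>" "\<theta> < 1" using assms by (auto simp: \<theta>_def)
  have x: "ln x = ln \<theta> + ln y" using assms by (simp add: \<theta>_def ln_div)
  have "- ln \<theta> \<le> 1 / \<theta> - 1" using ln_le_minus_one[of "1 / \<theta>"] \<theta> by (simp add: ln_div)
  hence "\<theta> * (- ln \<theta>) \<le> \<theta> * (1 / \<theta> - 1)" using \<theta> by (intro mult_left_mono) auto
  hence "- \<theta> * ln \<theta> \<le> 1 - \<theta>" using \<theta> by (simp add: algebra_simps)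
  moreover have "(1 - \<theta>) * (ln y + 1) \<le> 0" using \<theta> y by (intro mult_nonneg_nonpos) auto
  moreover have "\<theta> * ln (1 - x) \<le> 0" using assms \<theta> by (intro mult_nonneg_nonpos) auto
  moreover have "ln (1 - y) \<le> ln (1 - x)" using assms by simp
  ultimately show ?thesis unfolding \<theta>_def[symmetric] x by (simp add: algebra_simps)
qed

subsection \<open>Growth of the fundamental polynomials of Leja points\<close>

text \<open>Shannon entropy of the weights u/(u+t) and t/(u+t), expanded so that the interval and
  its two arms contribute separate logarithms.\<close>

definition weighted_entropy :: "real \<Rightarrow> real \<Rightarrow> real" where
  "weighted_entropy u t = ln (u + t) - u / (u + t) * ln u - t / (u + t) * ln t"

lemma weighted_entropy_commute: "weighted_entropy u t = weighted_entropy t u"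
  by (simp add: weighted_entropy_def add.commute)

lemma weighted_entropy_alt:
  assumes "0 < u" "0 < t"
  shows "weighted_entropy u t = u / (u + t) * (ln (u + t) - ln u) + t / (u + t) * (ln (u + t) - ln t)"
proof -
  have "u / (u + t) + t / (u + t) = 1" using assms by (simp flip: add_divide_distrib)
  hence "ln (u + t) = (u / (u + t) + t / (u + t)) * ln (u + t)" by simp
  thus ?thesis unfolding weighted_entropy_def by (simp add: algebra_simps)
qed

text \<open>Each summand is estimated by the tangent of \<open>ln\<close> at 2, and the corrections
  1/2 - w/(u+t) add up to 0. The factor 2 of the theorem originates here.\<close>

lemma weighted_entropy_le:
  assumes "0 < u" "0 < t"
  shows "weighted_entropy u t \<le> ln 2"
proof -
  have *: "w / (u + t) * (ln (u + t) - ln w) \<le> w / (u + t) * ln 2 + 1 / 2 - w / (u + t)"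
    if "0 < w" for w
  proof -
    have "ln ((u + t) / w) \<le> ln 2 + (u + t) / w / 2 - 1"
      using assms that by (intro ln_le_scaled) auto
    hence "w / (u + t) * ln ((u + t) / w) \<le> w / (u + t) * (ln 2 + (u + t) / w / 2 - 1)"
      using assms that by (intro mult_left_mono) auto
    also have "\<dots> = w / (u + t) * ln 2 + 1 / 2 - w / (u + t)"
    proof -
      have "w / L * (ln 2 + L / w / 2 - 1) = w / L * ln 2 + 1 / 2 - w / L" if "L > 0" for L
        using \<open>0 < w\<close> that by (simp add: field_simps)
      thus ?thesis using assms by simp
    qed
    finally show ?thesis using assms that by (simp add: ln_div)
  qed
  have "u / (u + t) + t / (u + t) = 1" using assms by (simp flip: add_divide_distrib)
  hence "u / (u + t) * ln 2 + t / (u + t) * ln 2 = ln 2" by (metis distrib_right mult_1)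
  with *[OF assms(1)] *[OF assms(2)] \<open>u / (u + t) + t / (u + t) = 1\<close>
  show ?thesis unfolding weighted_entropy_alt[OF assms] by linarith
qed

text \<open>\<open>a\<close>, \<open>c\<close> and \<open>e\<close> are the logarithms of \<open>f\<close> at \<open>t\<close>, \<open>-u\<close> and the next node \<open>v\<close>. The coefficients 7/8 and
1/8 + 1/8 of the logarithms of the length of the interval and of its two arms add up to the exponent 9/8.\<close>

lemma interval_shrinking_step:
  fixes t u v a c e B :: real
  assumes pos: "0 < v" "v < t" "0 < u"
    and a: "a + ln t \<le> e + ln v" and c: "c + ln u \<le> e + ln v"
    and IH: "weighted_entropy u v + u / (u + v) * e + v / (u + v) * c \<le> B"
  shows "weighted_entropy u t + u / (u + t) * (a + ln (t - v) - ln v)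
           + t / (u + t) * (c + ln (u + v) - ln v)
         \<le> B + 7/8 * (ln (u + t) - ln (u + v)) + 1/8 * (ln t - ln v)"
proof -
  define p where "p = t / (u + t)"
  define p' where "p' = v / (u + v)"
  have q: "u / (u + t) = 1 - p" and q': "u / (u + v) = 1 - p'"
    using pos by (auto simp: p_def p'_def field_simps)
  have "p' \<le> p" "p \<le> 1" using pos by (auto simp: p_def p'_def field_simps)
  \<comment> \<open>The Leja bounds trade a for e completely, but c for e only with the excess
    weight p - p'. The weights of e and c then agree with those in \<open>IH\<close>.\<close>
  have m1: "(1 - p) * a \<le> (1 - p) * (e + ln v - ln t)"
    using a \<open>p \<le> 1\<close> by (intro mult_left_mono) auto
  have m2: "(p - p') * c \<le> (p - p') * (e + ln v - ln u)"
    using c \<open>p' \<le> p\<close> by (intro mult_left_mono) auto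
  \<comment> \<open>Shares of the gap between v and t in the whole interval and in the arm t, so
    that p = x / y.\<close>
  define x where "x = (t - v) / (u + t)"
  define y where "y = (t - v) / t"
  have "0 < x" "x < y" "y < 1" using pos by (auto simp: x_def y_def field_simps)
  from two_variable_bound[OF this]
  have "8 * ln y - 8 * p * ln x + (8 * p - 1) * ln (1 - x) + ln (1 - y) \<le> 0"
    using pos by (simp add: x_def y_def p_def)
  moreover have "1 - x = (u + v) / (u + t)" "1 - y = v / t"
    using pos by (auto simp: x_def y_def field_simps)
  ultimately have num: "8 * (ln (t - v) - ln t) - 8 * p * (ln (t - v) - ln (u + t))
      + (8 * p - 1) * (ln (u + v) - ln (u + t)) + (ln v - ln t) \<le> 0"
    using pos by (simp add: x_def y_def ln_div)
  show ?thesis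
    using m1 m2 num IH
    unfolding weighted_entropy_def p_def[symmetric] p'_def[symmetric] q q'
    by (simp add: field_simps)
qed

text \<open>\<open>f m\<close> is the modulus of the Lagrange fundamental polynomial of the node \<open>x\<^sub>k\<close> with respect to
\<open>x\<^sub>0, \<dots>, x\<^bsub>k+m\<^esub>\<close>, in the coordinate \<open>s = x - x\<^sub>k\<close>; \<open>y m\<close> is the next node.\<close>

locale leja_ratio =
  fixes S :: "real set" and f :: "nat \<Rightarrow> real \<Rightarrow> real" and y :: "nat \<Rightarrow> real"
    and N :: nat and d :: real
  assumes f_0_nonneg: "\<And>s. f 0 s \<ge> 0"
    and f_0_le: "\<And>s. s \<in> S \<Longrightarrow> f 0 s \<le> 1"
    and f_Suc: "\<And>m s. m < N \<Longrightarrow> f (Suc m) s = f m s * \<bar>1 - s / y m\<bar>"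
    and y_in: "\<And>m. m < N \<Longrightarrow> y m \<in> S"
    and y_ge: "\<And>m. m < N \<Longrightarrow> d \<le> \<bar>y m\<bar>"
    and d_pos: "d > 0"
    and leja: "\<And>m s. m < N \<Longrightarrow> s \<in> S \<Longrightarrow> f m s * \<bar>s\<bar> \<le> f m (y m) * \<bar>y m\<bar>"
begin

lemma f_nonneg: "m \<le> N \<Longrightarrow> f m s \<ge> 0"
  by (induction m) (auto simp: f_0_nonneg f_Suc)

text \<open>Weighted mean of the logarithms of f m t (|s|+|t|)/|s| and f m s (|s|+|t|)/|t|. For s, t
  of opposite sign each quotient is the growth at one end point when the other is taken as a
  node.\<close>

definition log_mean :: "nat \<Rightarrow> real \<Rightarrow> real \<Rightarrow> real" where
  "log_mean m s t = weighted_entropy \<bar>s\<bar> \<bar>t\<bar>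
     + \<bar>s\<bar> / (\<bar>s\<bar> + \<bar>t\<bar>) * ln (f m t) + \<bar>t\<bar> / (\<bar>s\<bar> + \<bar>t\<bar>) * ln (f m s)"

text \<open>When an end point moves from v out to t with d \<le> |v| < |t|, this grows by exactly
  the loss allowed in \<open>interval_shrinking_step\<close>. The \<open>max 1\<close> covers end
  points closer to 0 than d, since only nodes are known to be separated.\<close>

definition potential :: "real \<Rightarrow> real \<Rightarrow> real" where
  "potential s t = ln 2 + 7/8 * ln ((\<bar>s\<bar> + \<bar>t\<bar>) / d)
     + 1/8 * ln (max 1 (\<bar>s\<bar> / d)) + 1/8 * ln (max 1 (\<bar>t\<bar> / d))"

lemma log_mean_commute: "log_mean m s t = log_mean m t s"
  by (simp add: log_mean_def weighted_entropy_commute[of "\<bar>s\<bar>"] add.commute)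

lemma potential_commute: "potential s t = potential t s"
  by (simp add: potential_def add.commute)

text \<open>Since \<open>ln 0 = 0\<close>, the logarithmic form of the Leja property needs positive
  values; the property itself passes positivity on to the next node.\<close>

lemma f_pos_leja:
  assumes "m < N" "t \<in> S" "t \<noteq> 0" "f m t > 0"
  shows "f m (y m) > 0" "ln (f m t) + ln \<bar>t\<bar> \<le> ln (f m (y m)) + ln \<bar>y m\<bar>"
proof -
  have "y m \<noteq> 0" using y_ge[of m] d_pos assms by auto
  have *: "0 < f m t * \<bar>t\<bar>" using assms by simp
  also have le: "\<dots> \<le> f m (y m) * \<bar>y m\<bar>" using leja assms by blast
  finally show pos: "f m (y m) > 0" using \<open>y m \<noteq> 0\<close> by (simp add: zero_less_mult_iff)
  have "ln (f m t * \<bar>t\<bar>) \<le> ln (f m (y m) * \<bar>y m\<bar>)" using le * by simp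
  thus "ln (f m t) + ln \<bar>t\<bar> \<le> ln (f m (y m)) + ln \<bar>y m\<bar>"
    using assms \<open>y m \<noteq> 0\<close> pos by (simp add: ln_mult)
qed

lemma log_mean_step_inside:
  assumes m: "m < N" and S: "s \<in> S" "t \<in> S" and sgn: "s * t < 0" "0 < y m * t" "\<bar>y m\<bar> < \<bar>t\<bar>"
    and pos: "f m s > 0" "f m t > 0"
    and IH: "log_mean m s (y m) \<le> potential s (y m)"
  shows "log_mean (Suc m) s t \<le> potential s t"
proof -
  define v where "v = y m"
  have nz: "s \<noteq> 0" "t \<noteq> 0" "v \<noteq> 0" using sgn by (auto simp: v_def)
  have v_ge: "d \<le> \<bar>v\<bar>" using y_ge m by (simp add: v_def)
  have at: "\<bar>1 - t / v\<bar> = (\<bar>t\<bar> - \<bar>v\<bar>) / \<bar>v\<bar>" and as: "\<bar>1 - s / v\<bar> = (\<bar>s\<bar> + \<bar>v\<bar>) / \<bar>v\<bar>"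
    using sgn nz unfolding v_def[symmetric]
    by (auto simp: abs_if mult_less_0_iff zero_less_mult_iff field_simps split: if_splits)
  have "ln (f (Suc m) t) = ln (f m t) + ln (\<bar>t\<bar> - \<bar>v\<bar>) - ln \<bar>v\<bar>"
    using pos sgn nz m by (simp add: f_Suc v_def[symmetric] at ln_mult ln_div)
  moreover have "ln (f (Suc m) s) = ln (f m s) + ln (\<bar>s\<bar> + \<bar>v\<bar>) - ln \<bar>v\<bar>"
  proof -
    have "\<bar>s\<bar> + \<bar>v\<bar> > 0" using nz by simp
    thus ?thesis using pos nz m
      by (simp add: f_Suc v_def[symmetric] as ln_mult_pos ln_divide_pos del: abs_add_abs)
  qed
  moreover have "weighted_entropy \<bar>s\<bar> \<bar>t\<bar>
      + \<bar>s\<bar> / (\<bar>s\<bar> + \<bar>t\<bar>) * (ln (f m t) + ln (\<bar>t\<bar> - \<bar>v\<bar>) - ln \<bar>v\<bar>)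
      + \<bar>t\<bar> / (\<bar>s\<bar> + \<bar>t\<bar>) * (ln (f m s) + ln (\<bar>s\<bar> + \<bar>v\<bar>) - ln \<bar>v\<bar>)
      \<le> potential s v + 7/8 * (ln (\<bar>s\<bar> + \<bar>t\<bar>) - ln (\<bar>s\<bar> + \<bar>v\<bar>)) + 1/8 * (ln \<bar>t\<bar> - ln \<bar>v\<bar>)"
    using f_pos_leja[OF m S(1) nz(1) pos(1)] f_pos_leja[OF m S(2) nz(2) pos(2)] nz sgn IH
    by (intro interval_shrinking_step[where e = "ln (f m v)"]) (auto simp: v_def log_mean_def)
  \<comment> \<open>Because d \<le> |v| < |t|, both clamps are inactive and the allowed loss is the
    exact change of the potential.\<close>
  moreover have "potential s t = potential s v
      + 7/8 * (ln (\<bar>s\<bar> + \<bar>t\<bar>) - ln (\<bar>s\<bar> + \<bar>v\<bar>)) + 1/8 * (ln \<bar>t\<bar> - ln \<bar>v\<bar>)"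
  proof -
    have "max 1 (\<bar>t\<bar> / d) = \<bar>t\<bar> / d" "max 1 (\<bar>v\<bar> / d) = \<bar>v\<bar> / d"
      using v_ge sgn d_pos by (auto simp: v_def max_def field_simps)
    moreover have "ln ((\<bar>s\<bar> + \<bar>r\<bar>) / d) = ln (\<bar>s\<bar> + \<bar>r\<bar>) - ln d" for r
      using nz d_pos by (intro ln_divide_pos) auto
    moreover have "ln (\<bar>t\<bar> / d) = ln \<bar>t\<bar> - ln d" "ln (\<bar>v\<bar> / d) = ln \<bar>v\<bar> - ln d"
      using nz d_pos by (auto intro!: ln_divide_pos)
    ultimately show ?thesis unfolding potential_def by (simp only:) argo
  qed
  ultimately show ?thesis by (simp add: log_mean_def)
qed

text \<open>At both end points r / v \<le> 1, hence ln |1 - r/v| \<le> -r/v; the linear terms cancel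
  because |s| t + |t| s = 0.\<close>

lemma log_mean_step_outside:
  assumes m: "m < N" and sgn: "s * t < 0"
    and out: "0 < y m * t \<Longrightarrow> \<bar>t\<bar> \<le> \<bar>y m\<bar>" "0 < y m * s \<Longrightarrow> \<bar>s\<bar> \<le> \<bar>y m\<bar>"
    and pos: "f (Suc m) s > 0" "f (Suc m) t > 0"
  shows "log_mean (Suc m) s t \<le> log_mean m s t"
proof -
  define v where "v = y m"
  have nz: "s \<noteq> 0" "t \<noteq> 0" "v \<noteq> 0" using sgn y_ge[OF m] d_pos by (auto simp: v_def)
  have *: "ln (f (Suc m) r) \<le> ln (f m r) - r / v"
    if r: "f (Suc m) r > 0" "0 < v * r \<Longrightarrow> \<bar>r\<bar> \<le> \<bar>v\<bar>" for r
  proof -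
    have fr: "f m r > 0" "\<bar>1 - r / v\<bar> > 0"
      using r(1) f_nonneg[of m r] m by (auto simp: f_Suc v_def zero_less_mult_iff)
    have "r / v \<le> 1"
    proof (cases "0 < v * r")
      case True
      hence "\<bar>r / v\<bar> \<le> 1" using r(2) nz by (simp add: abs_divide divide_le_eq_1)
      thus ?thesis by linarith
    next
      case False
      hence "r / v \<le> 0" by (auto simp: divide_le_0_iff zero_less_mult_iff)
      thus ?thesis by linarith
    qed
    hence "ln \<bar>1 - r / v\<bar> \<le> - r / v" using ln_le_minus_one[of "1 - r / v"] fr by simp
    thus ?thesis using fr m by (simp add: f_Suc v_def[symmetric] ln_mult)
  qed
  define \<alpha> \<beta> where "\<alpha> = \<bar>s\<bar> / (\<bar>s\<bar> + \<bar>t\<bar>)" and "\<beta> = \<bar>t\<bar> / (\<bar>s\<bar> + \<bar>t\<bar>)"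
  have "\<alpha> * ln (f (Suc m) t) \<le> \<alpha> * (ln (f m t) - t / v)"
    using *[of t] pos out by (intro mult_left_mono) (auto simp: v_def \<alpha>_def)
  moreover have "\<beta> * ln (f (Suc m) s) \<le> \<beta> * (ln (f m s) - s / v)"
    using *[of s] pos out by (intro mult_left_mono) (auto simp: v_def \<beta>_def)
  moreover have "\<alpha> * (t / v) + \<beta> * (s / v) = 0"
    using sgn by (auto simp: \<alpha>_def \<beta>_def abs_if mult_less_0_iff)
  ultimately show ?thesis
    unfolding log_mean_def \<alpha>_def[symmetric] \<beta>_def[symmetric] by (simp add: algebra_simps)
qed

text \<open>Induction with s and t free, since an inner node replaces the end point on its side. The
  condition d \<le> |s| + |t| makes the length term nonnegative at m = 0 and persists because every
  node has modulus at least d.\<close>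

lemma log_mean_le_potential:
  assumes "m \<le> N" "s \<in> S" "t \<in> S" "s * t < 0" "d \<le> \<bar>s\<bar> + \<bar>t\<bar>" "f m s > 0" "f m t > 0"
  shows "log_mean m s t \<le> potential s t"
  using assms
proof (induction m arbitrary: s t)
  case 0
  have "s \<noteq> 0" "t \<noteq> 0" using 0 by auto
  hence "weighted_entropy \<bar>s\<bar> \<bar>t\<bar> \<le> ln 2" by (intro weighted_entropy_le) auto
  moreover have "\<bar>s\<bar> / (\<bar>s\<bar> + \<bar>t\<bar>) * ln (f 0 t) \<le> 0" "\<bar>t\<bar> / (\<bar>s\<bar> + \<bar>t\<bar>) * ln (f 0 s) \<le> 0"
    using f_0_le 0 by (intro mult_nonneg_nonpos; simp)+
  moreover have "ln ((\<bar>s\<bar> + \<bar>t\<bar>) / d) \<ge> 0" "ln (max 1 (\<bar>s\<bar> / d)) \<ge> 0" "ln (max 1 (\<bar>t\<bar> / d)) \<ge> 0"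
    using 0 d_pos by (auto intro!: ln_ge_zero)
  ultimately show ?case unfolding log_mean_def potential_def by linarith
next
  case (Suc m)
  have m: "m < N" using Suc.prems by simp
  have pos: "f m s > 0" "f m t > 0"
    using Suc.prems f_nonneg[of m] m by (auto simp: f_Suc zero_less_mult_iff)
  have nz: "s \<noteq> 0" "t \<noteq> 0" using Suc.prems by auto
  have ym: "d \<le> \<bar>y m\<bar>" "y m \<in> S" using y_ge y_in m by auto
  consider "0 < y m * t" "\<bar>y m\<bar> < \<bar>t\<bar>" | "0 < y m * s" "\<bar>y m\<bar> < \<bar>s\<bar>"
    | "0 < y m * t \<Longrightarrow> \<bar>t\<bar> \<le> \<bar>y m\<bar>" "0 < y m * s \<Longrightarrow> \<bar>s\<bar> \<le> \<bar>y m\<bar>"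
    by linarith
  thus ?case
  proof cases
    case 1
    have "s * y m < 0" using 1 Suc.prems by (auto simp: zero_less_mult_iff mult_less_0_iff)
    hence "log_mean m s (y m) \<le> potential s (y m)"
      using f_pos_leja(1)[OF m Suc.prems(3) nz(2) pos(2)] Suc.prems pos ym by (intro Suc.IH) auto
    thus ?thesis using Suc.prems pos 1 m by (intro log_mean_step_inside) auto
  next
    case 2
    have "t * y m < 0" using 2 Suc.prems by (auto simp: zero_less_mult_iff mult_less_0_iff)
    hence "log_mean m t (y m) \<le> potential t (y m)"
      using f_pos_leja(1)[OF m Suc.prems(2) nz(1) pos(1)] Suc.prems pos ym by (intro Suc.IH) auto
    hence "log_mean (Suc m) t s \<le> potential t s"
      using Suc.prems pos 2 m by (intro log_mean_step_inside) (auto simp: mult.commute)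
    thus ?thesis by (simp add: log_mean_commute[of _ t] potential_commute[of t])
  next
    case 3
    have "log_mean (Suc m) s t \<le> log_mean m s t"
      using 3 Suc.prems m by (intro log_mean_step_outside) auto
    also have "\<dots> \<le> potential s t" using Suc.prems pos by (intro Suc.IH) auto
    finally show ?thesis .
  qed
qed

lemma potential_le:
  assumes "\<bar>s\<bar> + \<bar>t\<bar> \<le> D" "d \<le> D" "s \<noteq> 0"
  shows "potential s t \<le> ln 2 + 9/8 * ln (D / d)"
proof -
  have "ln ((\<bar>s\<bar> + \<bar>t\<bar>) / d) \<le> ln (D / d)"
    using assms d_pos by (subst ln_le_cancel_iff) (auto simp: divide_right_mono)
  moreover have "ln (max 1 (\<bar>r\<bar> / d)) \<le> ln (D / d)" if "\<bar>r\<bar> \<le> D" for r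
    using that assms d_pos by (subst ln_le_cancel_iff) (auto simp: divide_right_mono)
  from this[of s] this[of t] have "ln (max 1 (\<bar>s\<bar> / d)) \<le> ln (D / d)" "ln (max 1 (\<bar>t\<bar> / d)) \<le> ln (D / d)"
    using assms by auto
  ultimately show ?thesis unfolding potential_def by linarith
qed

text \<open>Only a node across 0 needs the potential: for t/v in [0, 2] the new factor is at most 1,
  and for t/v > 2 it is below |t|/|v|, so the Leja property bounds the new value by f m v.\<close>

lemma f_bound:
  assumes D: "\<And>s t. s \<in> S \<Longrightarrow> t \<in> S \<Longrightarrow> \<bar>s - t\<bar> \<le> D" "d \<le> D"
    and "m \<le> N" "t \<in> S"
  shows "f m t \<le> 2 * (D / d) powr (9/8)"
  using assms(3,4)
proof (induction m arbitrary: t)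
  case 0
  have "1 \<le> (D / d) powr (9/8)" using D d_pos by (intro ge_one_powr_ge_zero) auto
  thus ?case using f_0_le[OF 0(2)] by simp
next
  case (Suc m)
  define v where "v = y m"
  have m: "m < N" using Suc.prems by simp
  have v: "v \<noteq> 0" "v \<in> S" "d \<le> \<bar>v\<bar>" using y_ge[OF m] y_in[OF m] d_pos by (auto simp: v_def)
  have fS: "f (Suc m) t = f m t * \<bar>1 - t / v\<bar>" using m by (simp add: f_Suc v_def)
  have IH: "f m s \<le> 2 * (D / d) powr (9/8)" if "s \<in> S" for s using Suc that by simp
  consider "f m t = 0" | "\<bar>1 - t / v\<bar> \<le> 1" | "t / v > 2" | "t / v < 0" "f m t > 0"
    using f_nonneg[of m t] m by force
  thus ?case
  proof cases
    case 1
    thus ?thesis by (simp add: fS)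
  next
    case 2
    hence "f (Suc m) t \<le> f m t" unfolding fS using f_nonneg[of m t] m by (intro mult_left_le) auto
    thus ?thesis using IH[OF Suc.prems(2)] by simp
  next
    case 3
    have "f (Suc m) t \<le> f m t * (t / v)"
      unfolding fS using 3 f_nonneg[of m t] m by (intro mult_left_mono) auto
    also have "t / v = \<bar>t\<bar> / \<bar>v\<bar>" using 3 by (metis abs_divide abs_of_pos less_trans zero_less_numeral)
    also have "f m t * (\<bar>t\<bar> / \<bar>v\<bar>) \<le> f m v"
      using leja[OF m Suc.prems(2)] v by (simp add: v_def field_simps)
    finally show ?thesis using IH[OF v(2)] by simp
  next
    case 4
    have t0: "t \<noteq> 0" using 4 by auto
    have vt: "v * t < 0" using 4 by (auto simp: divide_less_0_iff mult_less_0_iff)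
    have fv: "f m v > 0" "ln (f m t) + ln \<bar>t\<bar> \<le> ln (f m v) + ln \<bar>v\<bar>"
      using f_pos_leja[OF m Suc.prems(2) t0 4(2)] by (auto simp: v_def)
    have len: "\<bar>v\<bar> + \<bar>t\<bar> = \<bar>v - t\<bar>" using vt by (auto simp: abs_if mult_less_0_iff)
    have "1 - t / v = (v - t) / v" using v by (simp add: field_simps)
    hence "\<bar>1 - t / v\<bar> = (\<bar>v\<bar> + \<bar>t\<bar>) / \<bar>v\<bar>" by (simp only: len abs_divide)
    hence X: "ln (f (Suc m) t) = ln (f m t) + ln (\<bar>v\<bar> + \<bar>t\<bar>) - ln \<bar>v\<bar>" (is "?X = _")
      and pos: "f (Suc m) t > 0"
      using 4 t0 v by (auto simp: fS ln_mult ln_div add_pos_pos)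
    define p where "p = \<bar>t\<bar> / (\<bar>v\<bar> + \<bar>t\<bar>)"
    have p: "0 \<le> p" "\<bar>v\<bar> / (\<bar>v\<bar> + \<bar>t\<bar>) = 1 - p" using v by (auto simp: p_def field_simps)
    \<comment> \<open>The Leja property is applied to the share p alone, moving it from t to v; this
      yields exactly \<open>log_mean m v t\<close>.\<close>
    have "p * ?X \<le> p * (ln (f m v) + ln (\<bar>v\<bar> + \<bar>t\<bar>) - ln \<bar>t\<bar>)"
      using X fv p by (intro mult_left_mono) auto
    hence "?X \<le> (1 - p) * (ln (f m t) + ln (\<bar>v\<bar> + \<bar>t\<bar>) - ln \<bar>v\<bar>)
        + p * (ln (f m v) + ln (\<bar>v\<bar> + \<bar>t\<bar>) - ln \<bar>t\<bar>)"
      unfolding X by (simp add: algebra_simps)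
    also have "\<dots> = log_mean m v t"
      unfolding log_mean_def weighted_entropy_def p p_def[symmetric] by (simp add: algebra_simps)
    also have "\<dots> \<le> potential v t"
      using Suc.prems v vt fv 4 m by (intro log_mean_le_potential) auto
    also have "\<dots> \<le> ln 2 + 9/8 * ln (D / d)"
      using D(1)[OF v(2) Suc.prems(2)] len D v by (intro potential_le) auto
    also have "\<dots> = ln (2 * (D / d) powr (9/8))"
      using D d_pos by (simp add: ln_mult ln_powr)
    finally show ?thesis using pos D d_pos by (subst (asm) ln_le_cancel_iff) auto
  qed
qed

end

subsection \<open>Separation of Leja points\<close>

text \<open>Locally g is a real part, so exp (-c g) is locally the modulus of a holomorphic
  function; no global harmonic conjugate is required.\<close>

lemma regular_green_exp_local:
  assumes "regular_green K g" "z \<notin> K"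
  obtains r h where "r > 0" "ball z r \<subseteq> - K" "h holomorphic_on ball z r"
    "\<And>w. w \<in> ball z r \<Longrightarrow> cmod (h w) = exp (- c * g w)"
proof -
  from assms obtain r f where r: "r > 0" "ball z r \<subseteq> - K" "f holomorphic_on ball z r"
    "\<forall>w\<in>ball z r. g w = Re (f w)"
    unfolding regular_green_def harmonic_on_def by (metis ComplI)
  show ?thesis
  proof (rule that[of r "\<lambda>w. exp (- of_real c * f w)"])
    show "(\<lambda>w. exp (- of_real c * f w)) holomorphic_on ball z r"
      by (intro holomorphic_intros r)
  qed (use r in auto)
qed

text \<open>A value above M \<ge> 0 exceeds the limit at infinity, so a maximum is attained. The set
  of maximum points is open and closed, hence the whole plane, against the decay.\<close>

lemma maximum_principle_at_infinity:
  fixes \<phi> :: "complex \<Rightarrow> real"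
  assumes cont: "continuous_on UNIV \<phi>"
    and lim: "(\<phi> \<longlongrightarrow> 0) at_infinity"
    and local_max: "\<And>z. \<phi> z > M \<Longrightarrow> (\<And>w. \<phi> w \<le> \<phi> z) \<Longrightarrow> \<exists>r>0. \<forall>w\<in>ball z r. \<phi> w = \<phi> z"
    and "M \<ge> 0"
  shows "\<phi> z \<le> M"
proof (rule ccontr)
  assume "\<not> \<phi> z \<le> M"
  hence z: "\<phi> z > M" by simp
  hence "eventually (\<lambda>w. \<phi> w < \<phi> z) at_infinity"
    using order_tendstoD(2)[OF lim, of "\<phi> z"] \<open>M \<ge> 0\<close> by auto
  then obtain R where R: "\<And>w. norm w \<ge> R \<Longrightarrow> \<phi> w < \<phi> z"
    unfolding eventually_at_infinity by blast
  have "z \<in> cball 0 R" using R[of z] by force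
  moreover have "compact (cball (0::complex) R)" by simp
  moreover have "continuous_on (cball 0 R) \<phi>" using cont continuous_on_subset by blast
  ultimately obtain z0 where z0: "z0 \<in> cball 0 R" "\<And>w. w \<in> cball 0 R \<Longrightarrow> \<phi> w \<le> \<phi> z0"
    using continuous_attains_sup[of "cball 0 R" \<phi>] by (metis empty_iff)
  have max: "\<phi> w \<le> \<phi> z0" for w
    using z0(2)[of w] z0(2)[of z] R[of w] \<open>z \<in> cball 0 R\<close> by (cases "norm w \<le> R") force+
  define Z where "Z = {w. \<phi> w = \<phi> z0}"
  have "closed Z" unfolding Z_def
    using continuous_closed_vimage[of "{\<phi> z0}" \<phi>] cont
    by (simp add: continuous_on_eq_continuous_at vimage_def)
  moreover have "open Z" unfolding open_contains_ball
  proof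
    fix w assume w: "w \<in> Z"
    hence "\<exists>r>0. \<forall>v\<in>ball w r. \<phi> v = \<phi> w"
      using local_max[of w] max z max[of z] by (auto simp: Z_def)
    thus "\<exists>r>0. ball w r \<subseteq> Z" using w by (auto simp: Z_def)
  qed
  ultimately have "Z = UNIV" using clopen[of Z] by (auto simp: Z_def)
  hence "\<phi> (of_real (max R (norm z))) = \<phi> z" by (metis (mono_tags, lifting) Z_def UNIV_I mem_Collect_eq)
  moreover have "R \<le> cmod (of_real (max R (norm z)))" unfolding norm_of_real by linarith
  ultimately show False using R by fastforce
qed

text \<open>The polynomial times exp (-(j + \<epsilon>) g) is bounded by M on K, where g = 0, and
  decays like |w|^(-\<epsilon>); a maximum above M would thus lie off K, where the maximum modulus
  principle applies. Finally \<epsilon> tends to 0.\<close>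

lemma bernstein_walsh:
  fixes a :: "nat \<Rightarrow> complex"
  assumes g: "regular_green K g" and M: "\<And>w. w \<in> K \<Longrightarrow> (\<Prod>i<j. cmod (w - a i)) \<le> M" "M \<ge> 0"
  shows "(\<Prod>i<j. cmod (z - a i)) \<le> M * exp (j * g z)"
proof -
  obtain R C where RC: "\<And>z. R \<le> cmod z \<Longrightarrow> \<bar>g z - ln (cmod z)\<bar> \<le> C"
    using g unfolding regular_green_def by blast
  have contg: "continuous_on UNIV g" and g0: "\<And>z. z \<in> K \<Longrightarrow> g z = 0"
    using g by (auto simp: regular_green_def)
  \<comment> \<open>The extra \<epsilon> makes the comparison function tend to 0 at infinity, so that its maximum is attained.\<close>
  have *: "(\<Prod>i<j. cmod (z - a i)) \<le> M * exp ((j + \<epsilon>) * g z)" if "\<epsilon> > 0" for \<epsilon> :: real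
  proof -
    define c where "c = j + \<epsilon>"
    define \<phi> where "\<phi> = (\<lambda>w. (\<Prod>i<j. cmod (w - a i)) * exp (- c * g w))"
    have "\<phi> z \<le> M"
    proof (rule maximum_principle_at_infinity[OF _ _ _ M(2)])
      show "continuous_on UNIV \<phi>" unfolding \<phi>_def by (intro continuous_intros contg)
      show "(\<phi> \<longlongrightarrow> 0) at_infinity"
      proof (rule Lim_null_comparison)
        define B where "B = 1 + Max (insert 0 (cmod ` a ` {..<j}))"
        have aB: "cmod (a i) \<le> B" if "i < j" for i
        proof -
          have "cmod (a i) \<le> Max (insert 0 (cmod ` a ` {..<j}))" using that by (intro Max_ge) auto
          thus ?thesis by (simp add: B_def)
        qed
        have "norm (\<phi> w) \<le> 2 ^ j * exp (c * C) * cmod w powr (-\<epsilon>)"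
          if w: "cmod w \<ge> max 1 (max B R)" for w
        proof -
          have "w \<noteq> 0" using w by force
          have "(\<Prod>i<j. cmod (w - a i)) \<le> (\<Prod>i<j. 2 * cmod w)"
          proof (rule prod_mono, safe)
            fix i assume "i < j"
            thus "cmod (w - a i) \<le> 2 * cmod w" using aB[of i] w norm_triangle_ineq4[of w "a i"] by auto
          qed auto
          also have "\<dots> = 2 ^ j * cmod w powr j"
            using \<open>w \<noteq> 0\<close> by (simp add: power_mult_distrib powr_realpow)
          finally have 1: "(\<Prod>i<j. cmod (w - a i)) \<le> 2 ^ j * cmod w powr j" .
          have "\<bar>g w - ln (cmod w)\<bar> \<le> C" using w by (intro RC) auto
          hence "c * (ln (cmod w) - C) \<le> c * g w" using that \<open>\<epsilon> > 0\<close> by (intro mult_left_mono) (auto simp: c_def)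
          hence "exp (- c * g w) \<le> exp (c * C + - c * ln (cmod w))" by (simp add: algebra_simps)
          also have "\<dots> = exp (c * C) * cmod w powr (-c)"
            using w by (subst exp_add) (auto simp: powr_def)
          finally have 2: "exp (- c * g w) \<le> exp (c * C) * cmod w powr (-c)" .
          have "\<phi> w \<le> (2 ^ j * cmod w powr j) * (exp (c * C) * cmod w powr (-c))"
            unfolding \<phi>_def using 1 2 by (intro mult_mono) auto
          also have "\<dots> = 2 ^ j * exp (c * C) * (cmod w powr j * cmod w powr (-c))" by simp
          also have "cmod w powr j * cmod w powr (-c) = cmod w powr (-\<epsilon>)"
            by (simp add: c_def flip: powr_add)
          finally show ?thesis by (simp add: \<phi>_def prod_nonneg abs_mult)
        qed
        thus "eventually (\<lambda>w. norm (\<phi> w) \<le> 2 ^ j * exp (c * C) * cmod w powr (-\<epsilon>)) at_infinity"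
          unfolding eventually_at_infinity by blast
        have "((\<lambda>w::complex. cmod w powr (-\<epsilon>)) \<longlongrightarrow> 0) at_infinity"
          using tendsto_neg_powr[of "-\<epsilon>" cmod at_infinity] that filterlim_norm_at_top by auto
        thus "((\<lambda>w. 2 ^ j * exp (c * C) * cmod w powr (-\<epsilon>)) \<longlongrightarrow> 0) at_infinity"
          by (rule tendsto_mult_right_zero)
      qed
      fix w assume w: "\<phi> w > M" "\<And>v. \<phi> v \<le> \<phi> w"
      have "w \<notin> K" using M(1)[of w] g0[of w] w(1) by (auto simp: \<phi>_def)
      then obtain r h where rh: "r > 0" "ball w r \<subseteq> - K" "h holomorphic_on ball w r"
        "\<And>v. v \<in> ball w r \<Longrightarrow> cmod (h v) = exp (- c * g v)"
        using regular_green_exp_local[OF g] by metis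
      define F where "F = (\<lambda>v. (\<Prod>i<j. v - a i) * h v)"
      have F: "cmod (F v) = \<phi> v" if "v \<in> ball w r" for v
        using rh(4)[OF that] by (simp add: F_def \<phi>_def norm_mult prod_norm)
      have "F constant_on ball w r"
      proof (rule maximum_modulus_principle[where U = "ball w r" and \<xi> = w])
        show "F holomorphic_on ball w r" unfolding F_def by (intro holomorphic_intros rh)
        show "cmod (F v) \<le> cmod (F w)" if "v \<in> ball w r" for v
          using that w(2)[of v] F rh(1) by simp
      qed (use rh in auto)
      hence "\<phi> v = \<phi> w" if "v \<in> ball w r" for v
        using F[OF that] F[of w] rh(1) that unfolding constant_on_def by (metis centre_in_ball)
      thus "\<exists>r>0. \<forall>v\<in>ball w r. \<phi> v = \<phi> w" using rh(1) by blast
    qed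
    hence "\<phi> z * exp (c * g z) \<le> M * exp (c * g z)" by (intro mult_right_mono) auto
    moreover have "\<phi> z * exp (c * g z) = (\<Prod>i<j. cmod (z - a i))"
      by (simp add: \<phi>_def mult.assoc flip: exp_add)
    ultimately show ?thesis unfolding c_def by linarith
  qed
  show ?thesis
  proof (rule tendsto_lowerbound)
    show "((\<lambda>\<epsilon>::real. M * exp ((j + \<epsilon>) * g z)) \<longlongrightarrow> M * exp (j * g z)) (at_right 0)"
      by (rule tendsto_eq_intros refl | simp)+
    show "eventually (\<lambda>\<epsilon>::real. (\<Prod>i<j. cmod (z - a i)) \<le> M * exp ((j + \<epsilon>) * g z)) (at_right 0)"
      using * by (simp add: eventually_at_filter)
  qed simp
qed

lemma green_G_upper:
  assumes "compact K" "K \<noteq> {}" "regular_green K g" "\<delta> > 0" "infdist z K \<le> 2 * \<delta>"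
  shows "g z \<le> green_G K g \<delta>"
proof -
  have cont: "continuous_on UNIV g" using assms by (simp add: regular_green_def)
  let ?A = "{z. infdist z K \<le> 2 * \<delta>}"
  have "compact ?A"
    using compact_infdist_le[OF assms(2,1), of "2 * \<delta>"] assms(4) by simp
  hence "compact (g ` ?A)" by (intro compact_continuous_image continuous_on_subset[OF cont]) auto
  hence "bdd_above (g ` ?A)" by (intro bounded_imp_bdd_above compact_imp_bounded)
  thus ?thesis unfolding green_G_def using assms(5) by (intro cSUP_upper) auto
qed

lemma green_G_nonneg:
  assumes "compact K" "K \<noteq> {}" "regular_green K g" "\<delta> > 0"
  shows "green_G K g \<delta> \<ge> 0"
proof -
  obtain z where "z \<in> K" using assms by blast
  moreover have "g z = 0" using \<open>z \<in> K\<close> assms by (simp add: regular_green_def)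
  ultimately show ?thesis using green_G_upper[OF assms, of z] assms by simp
qed

text \<open>Dividing the node polynomial by z - x k leaves \<open>Q\<close>, which is at most M
  exp(nG)/(2\<delta>) on the circle of radius 2\<delta> and hence at x j; but M = |x j - x k| |Q (x
  j)|.\<close>

lemma leja_separation:
  assumes K: "compact K" and g: "regular_green K g" and x: "leja_prefix K x n"
    and "\<delta> > 0" and "k < j" "j < n"
  shows "\<delta> * exp (- (real n * green_G K g \<delta>)) \<le> cmod (x j - x k)"
proof -
  define M where "M = (\<Prod>i<j. cmod (x j - x i))"
  define G where "G = green_G K g \<delta>"
  have xK: "x i \<in> K" if "i < n" for i using x that by (simp add: leja_prefix_def)
  have ne: "K \<noteq> {}" using xK \<open>j < n\<close> by blast
  have G: "G \<ge> 0" using green_G_nonneg[OF K ne g \<open>\<delta> > 0\<close>] by (simp add: G_def)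
  have le_M: "(\<Prod>i<j. cmod (w - x i)) \<le> M" if "w \<in> K" for w
    using x that \<open>j < n\<close> \<open>k < j\<close> by (auto simp: leja_prefix_def M_def)
  have M0: "M \<ge> 0" by (simp add: M_def prod_nonneg)
  note BW = bernstein_walsh[OF g le_M M0]
  \<comment> \<open>If M = 0, Bernstein-Walsh would make the node polynomial vanish on the whole
    plane.\<close>
  have "M > 0"
  proof (rule ccontr)
    assume "\<not> M > 0"
    hence "M = 0" using M0 by simp
    hence "(\<Prod>i<j. cmod (z - x i)) = 0" for z
      using BW[of z] prod_nonneg[of "{..<j}" "\<lambda>i. cmod (z - x i)"] by force
    hence "z \<in> x ` {..<j}" for z by force
    hence "UNIV = x ` {..<j}" by blast
    thus False using infinite_UNIV_char_0[where 'a = complex] by (metis finite_imageI finite_lessThan)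
  qed
  define Q where "Q = (\<lambda>z. \<Prod>i\<in>{..<j}-{k}. z - x i)"
  have Q: "(\<Prod>i<j. cmod (z - x i)) = cmod (z - x k) * cmod (Q z)" for z
    using prod.remove[of "{..<j}" k "\<lambda>i. cmod (z - x i)"] \<open>k < j\<close> by (simp add: Q_def prod_norm)
  show ?thesis
  proof (cases "cmod (x j - x k) < 2 * \<delta>")
    case False
    have "exp (- (real n * G)) \<le> 1" using G by simp
    hence "\<delta> * exp (- (real n * G)) \<le> \<delta> * 1" using \<open>\<delta> > 0\<close> by (intro mult_left_mono) auto
    thus ?thesis using False \<open>\<delta> > 0\<close> unfolding G_def by linarith
  next
    case True
    have "cmod (Q (x j)) \<le> M * exp (n * G) / (2 * \<delta>)"
    proof (rule maximum_modulus_frontier[where f = Q and S = "ball (x k) (2 * \<delta>)" and \<xi> = "x j"])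
      show "Q holomorphic_on interior (ball (x k) (2 * \<delta>))"
        unfolding Q_def by (intro holomorphic_intros)
      show "continuous_on (closure (ball (x k) (2 * \<delta>))) Q"
        unfolding Q_def by (intro continuous_intros)
      show "x j \<in> ball (x k) (2 * \<delta>)" using True by (simp add: dist_norm norm_minus_commute)
      fix z assume "z \<in> frontier (ball (x k) (2 * \<delta>))"
      hence z: "cmod (z - x k) = 2 * \<delta>" using \<open>\<delta> > 0\<close> by (simp add: dist_norm norm_minus_commute)
      have "infdist z K \<le> dist z (x k)" using xK \<open>k < j\<close> \<open>j < n\<close> by (intro infdist_le) auto
      hence "g z \<le> G" unfolding G_def using z by (intro green_G_upper[OF K ne g \<open>\<delta> > 0\<close>]) (auto simp: dist_norm)
      hence "real j * g z \<le> real j * G" by (intro mult_left_mono) auto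
      also have "\<dots> \<le> real n * G" using \<open>j < n\<close> G by (intro mult_right_mono) auto
      finally have "M * exp (j * g z) \<le> M * exp (n * G)" using M0 by (intro mult_left_mono) auto
      with BW[of z] have "2 * \<delta> * cmod (Q z) \<le> M * exp (n * G)" by (simp add: Q z)
      thus "cmod (Q z) \<le> M * exp (n * G) / (2 * \<delta>)" using \<open>\<delta> > 0\<close> by (simp add: field_simps)
    qed auto
    hence "M \<le> cmod (x j - x k) * (M * exp (n * G) / (2 * \<delta>))"
      unfolding M_def Q by (intro mult_left_mono) (auto simp: M_def Q)
    hence "M * 1 \<le> M * (cmod (x j - x k) * exp (n * G) / (2 * \<delta>))" by (simp add: field_simps)
    hence "1 \<le> cmod (x j - x k) * exp (n * G) / (2 * \<delta>)" using \<open>M > 0\<close> by (simp only: mult_le_cancel_left_pos)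
    hence "2 * \<delta> * exp (- (n * G)) \<le> cmod (x j - x k)"
      using \<open>\<delta> > 0\<close> by (simp add: field_simps exp_minus)
    moreover have "\<delta> * exp (- (n * G)) \<le> 2 * \<delta> * exp (- (n * G))"
      using \<open>\<delta> > 0\<close> by (intro mult_right_mono) auto
    ultimately show ?thesis by (simp add: G_def)
  qed
qed

text \<open>Bernstein-Walsh for the linear polynomial z - a at distance 2\<delta> from a. It covers
  n = 1, where no pair of nodes provides the bound.\<close>

lemma diameter_lower:
  assumes K: "compact K" and g: "regular_green K g" and "a \<in> K" and "\<delta> > 0" and "n \<ge> 1"
  shows "\<delta> * exp (- (real n * green_G K g \<delta>)) \<le> diameter K"
proof -
  have ne: "K \<noteq> {}" using \<open>a \<in> K\<close> by blast
  define z where "z = a + of_real (2 * \<delta>)"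
  define G where "G = green_G K g \<delta>"
  have z: "cmod (z - a) = 2 * \<delta>" using \<open>\<delta> > 0\<close> by (simp add: z_def)
  have "infdist z K \<le> dist z a" using \<open>a \<in> K\<close> by (rule infdist_le)
  hence gz: "g z \<le> G" unfolding G_def using z by (intro green_G_upper[OF K ne g \<open>\<delta> > 0\<close>]) (auto simp: dist_norm)
  have G: "G \<ge> 0" using green_G_nonneg[OF K ne g \<open>\<delta> > 0\<close>] by (simp add: G_def)
  have D: "diameter K \<ge> 0" using K by (intro diameter_ge_0 compact_imp_bounded)
  have "(\<Prod>i<1::nat. cmod (z - (\<lambda>_. a) i)) \<le> diameter K * exp (real 1 * g z)"
    using diameter_bounded_bound[OF compact_imp_bounded[OF K], of _ a] \<open>a \<in> K\<close> D
    by (intro bernstein_walsh[OF g]) (auto simp: dist_norm)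
  hence "2 * \<delta> \<le> diameter K * exp (g z)" using z by simp
  also have "\<dots> \<le> diameter K * exp (n * G)"
  proof -
    have "1 * G \<le> n * G" using G \<open>n \<ge> 1\<close> by (intro mult_right_mono) auto
    thus ?thesis using D gz by (intro mult_left_mono) auto
  qed
  finally have "\<delta> \<le> diameter K * exp (n * G)" using \<open>\<delta> > 0\<close> by simp
  thus ?thesis by (simp add: G_def exp_minus field_simps)
qed

subsection \<open>The Lebesgue constant\<close>

lemma lagrange_basis_bound:
  assumes K: "compact K" "K \<subseteq> \<real>" and g: "regular_green K g" and x: "leja_prefix K x n"
    and "\<delta> > 0" and "k < n" and "t \<in> K"
  shows "cmod (lagrange_basis x k n t)
           \<le> 2 * (diameter K / \<delta> * exp (real n * green_G K g \<delta>)) powr (9/8)"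
proof -
  define d where "d = \<delta> * exp (- (real n * green_G K g \<delta>))"
  define X where "X = (\<lambda>i. Re (x i))"
  define S where "S = (\<lambda>z. Re z - X k) ` K"
  define N where "N = n - Suc k"
  define y where "y = (\<lambda>m. X (Suc (k + m)) - X k)"
  \<comment> \<open>Index k + N is n - 1, so \<open>f N\<close> involves all n nodes except the
    k-th.\<close>
  define f where "f = (\<lambda>m s. \<Prod>i\<in>{..<Suc (k + m)} - {k}. \<bar>s + X k - X i\<bar> / \<bar>X k - X i\<bar>)"
  have real: "of_real (Re z) = z" if "z \<in> K" for z using that K(2) by (simp add: subset_iff)
  have xK: "x i \<in> K" if "i < n" for i using x that by (simp add: leja_prefix_def)
  have dist_Re: "cmod (z - w) = \<bar>Re z - Re w\<bar>" if "z \<in> K" "w \<in> K" for z w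
    using real[OF that(1)] real[OF that(2)] by (metis norm_of_real of_real_diff)
  have sep: "d \<le> \<bar>X j - X i\<bar>" if "i < j" "j < n" for i j
    using leja_separation[OF K(1) g x \<open>\<delta> > 0\<close> that] dist_Re xK that by (simp add: d_def X_def)
  have d: "d > 0" using \<open>\<delta> > 0\<close> by (simp add: d_def)
  have Leja: "(\<Prod>i<j. \<bar>s + X k - X i\<bar>) \<le> (\<Prod>i<j. \<bar>X j - X i\<bar>)" if "j < n" "s \<in> S" for j s
  proof (cases "j = 0")
    case False
    from \<open>s \<in> S\<close> obtain z where z: "z \<in> K" "s = Re z - X k" by (auto simp: S_def)
    have "(\<Prod>i<j. cmod (z - x i)) \<le> (\<Prod>i<j. cmod (x j - x i))"
      using x False z \<open>j < n\<close> by (auto simp: leja_prefix_def)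
    also have "(\<Prod>i<j. cmod (z - x i)) = (\<Prod>i<j. \<bar>s + X k - X i\<bar>)"
      using z xK \<open>j < n\<close> by (intro prod.cong) (auto simp: dist_Re X_def)
    also have "(\<Prod>i<j. cmod (x j - x i)) = (\<Prod>i<j. \<bar>X j - X i\<bar>)"
      using xK \<open>j < n\<close> by (intro prod.cong) (auto simp: dist_Re X_def)
    finally show ?thesis .
  qed simp
  interpret leja_ratio S f y N d
  proof
    show "f 0 s \<ge> 0" for s by (auto simp: f_def intro!: prod_nonneg)
    show "f 0 s \<le> 1" if "s \<in> S" for s
    proof -
      \<comment> \<open>Only the predecessors of node k remain, so its own Leja property gives the
        bound 1.\<close>
      have "{..<Suc (k + 0)} - {k} = {..<k}" by auto
      hence "f 0 s = (\<Prod>i<k. \<bar>s + X k - X i\<bar>) / (\<Prod>i<k. \<bar>X k - X i\<bar>)"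
        by (simp only: f_def prod_dividef)
      thus ?thesis using Leja[OF \<open>k < n\<close> that] prod_nonneg[of "{..<k}" "\<lambda>i. \<bar>X k - X i\<bar>"]
        by (smt (verit) divide_le_eq_1 divide_eq_0_iff)
    qed
    fix m assume m: "m < N"
    define j where "j = Suc (k + m)"
    have j: "k < j" "j < n" using m by (auto simp: j_def N_def)
    show y_ge: "d \<le> \<bar>y m\<bar>" using sep[OF j] by (simp add: y_def j_def)
    show "y m \<in> S" using xK[OF j(2)] by (auto simp: S_def y_def j_def X_def)
    fix s
    have "{..<Suc (k + Suc m)} - {k} = insert j ({..<Suc (k + m)} - {k})" by (auto simp: j_def)
    hence "f (Suc m) s = f m s * (\<bar>s + X k - X j\<bar> / \<bar>X k - X j\<bar>)"
      by (simp add: f_def j_def)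
    also have "\<bar>s + X k - X j\<bar> / \<bar>X k - X j\<bar> = \<bar>1 - s / y m\<bar>"
    proof -
      have "1 - s / y m = (s + X k - X j) / (X k - X j)"
        using y_ge d by (simp add: y_def j_def field_simps)
      thus ?thesis by (simp add: abs_divide)
    qed
    finally show "f (Suc m) s = f m s * \<bar>1 - s / y m\<bar>" .
    \<comment> \<open>The factor |r| restores the missing index k in the numerator, giving the full
      product that x j maximises.\<close>
    have f_alt: "f m r * \<bar>r\<bar> = (\<Prod>i<j. \<bar>r + X k - X i\<bar>) / (\<Prod>i\<in>{..<j} - {k}. \<bar>X k - X i\<bar>)" for r
      using prod.remove[of "{..<j}" k "\<lambda>i. \<bar>r + X k - X i\<bar>"] j
      by (simp add: f_def prod_dividef j_def mult.commute)
    show "f m s * \<bar>s\<bar> \<le> f m (y m) * \<bar>y m\<bar>" if "s \<in> S"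
      unfolding f_alt using Leja[OF j(2) that]
      by (intro divide_right_mono prod_nonneg) (auto simp: y_def j_def)
  qed (rule d)
  have "{0..<n} - {k} = {..<Suc (k + N)} - {k}" using \<open>k < n\<close> by (auto simp: N_def)
  hence "cmod (lagrange_basis x k n t) = (\<Prod>i\<in>{..<Suc (k + N)} - {k}. cmod (t - x i) / cmod (x k - x i))"
    by (simp add: lagrange_basis_def norm_divide flip: prod_norm)
  also have "\<dots> = f N (Re t - X k)"
    unfolding f_def using \<open>k < n\<close> \<open>t \<in> K\<close> xK
    by (intro prod.cong) (auto simp: dist_Re X_def N_def)
  also have "\<dots> \<le> 2 * (diameter K / d) powr (9/8)"
  proof (rule f_bound)
    show "\<bar>s - r\<bar> \<le> diameter K" if "s \<in> S" "r \<in> S" for s r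
      using that diameter_bounded_bound[OF compact_imp_bounded[OF K(1)]] dist_Re
      by (auto simp: S_def dist_norm)
    show "d \<le> diameter K"
      unfolding d_def using \<open>k < n\<close> by (intro diameter_lower[OF K(1) g \<open>t \<in> K\<close> \<open>\<delta> > 0\<close>]) auto
    show "Re t - X k \<in> S" using \<open>t \<in> K\<close> by (auto simp: S_def)
  qed simp
  also have "diameter K / d = diameter K / \<delta> * exp (real n * green_G K g \<delta>)"
    by (simp add: d_def exp_minus field_simps)
  finally show ?thesis .
qed

theorem theorem1:
  fixes K :: "complex set" and g :: "complex \<Rightarrow> real" and x :: "nat \<Rightarrow> complex"
    and n :: nat and \<delta> :: real
  assumes "compact K" and "K \<subseteq> \<real>"
    and "regular_green K g"
    and "n \<ge> 1" and "leja_prefix K x n"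
    and "\<delta> > 0"
  shows "lebesgue_const K x n
           \<le> 2 * real n * ((diameter K / \<delta>) * exp (real n * green_G K g \<delta>)) powr (9/8)"
proof -
  define B where "B = 2 * (diameter K / \<delta> * exp (real n * green_G K g \<delta>)) powr (9/8)"
  have xK: "x i \<in> K" if "i < n" for i using assms that by (simp add: leja_prefix_def)
  have ne: "K \<noteq> {}" using xK[of 0] assms by auto
  have bound: "cmod (lagrange_interp x n f t) \<le> real n * B"
    if f: "continuous_on K f" "(SUP t\<in>K. cmod (f t)) \<le> 1" and t: "t \<in> K" for f t
  proof -
    \<comment> \<open>A real \<open>SUP\<close> bounds its members only if the family is bounded
      above, here by compactness.\<close>
    have "bdd_above ((\<lambda>t. cmod (f t)) ` K)"
      using f(1) \<open>compact K\<close>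
      by (intro bounded_imp_bdd_above compact_imp_bounded compact_continuous_image continuous_intros)
    hence f1: "cmod (f s) \<le> 1" if "s \<in> K" for s using f(2) that cSUP_upper2 cSUP_upper order_trans by metis
    have "cmod (lagrange_interp x n f t) \<le> (\<Sum>k<n. cmod (f (x k) * lagrange_basis x k n t))"
      unfolding lagrange_interp_def by (rule norm_sum)
    also have "\<dots> \<le> (\<Sum>k<n. 1 * B)"
      unfolding norm_mult B_def using f1 xK t assms
      by (intro sum_mono mult_mono lagrange_basis_bound) auto
    finally show ?thesis by simp
  qed
  have "lebesgue_const K x n \<le> real n * B"
    unfolding lebesgue_const_def
  proof (rule cSup_least)
    \<comment> \<open>The zero function shows that the supremum is over a nonempty set.\<close>
    have "continuous_on K (\<lambda>_. 0 :: complex) \<and> (SUP t\<in>K. cmod 0) \<le> 1" using ne by simp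
    thus "{(SUP t\<in>K. cmod (lagrange_interp x n f t)) |f.
        continuous_on K f \<and> (SUP t\<in>K. cmod (f t)) \<le> 1} \<noteq> {}" by fast
  next
    fix c assume "c \<in> {(SUP t\<in>K. cmod (lagrange_interp x n f t)) |f.
        continuous_on K f \<and> (SUP t\<in>K. cmod (f t)) \<le> 1}"
    thus "c \<le> real n * B" using bound ne by (auto intro!: cSUP_least)
  qed
  thus ?thesis by (simp add: B_def algebra_simps)
qed

end
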